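(* Let $M\in\mathbb{R}^{n\times n}$ and assume $\lambda$ is a real eigenvalue of $M$ with geometric multiplicity $1$. Let $v_L$ and $v_R$ be (real) eigenvectors of $M^T$ and $M$, respectively, with eigenvalue $\lambda$. If $W\subseteq\mathbb{R}^n$ is an $M$-invariant subspace, then $v_R\in W$ or $v_L\in W^{\perp}$.
   Context: A subspace $W\subseteq\mathbb{R}^n$ is $M$-invariant if $MW\subseteq W$. $W^\perp$ is the orthogonal complement of $W$ in $\mathbb{R}^n$ with respect to the standard inner product. *)

theory Defs
  imports "HOL-Analysis.Analysis"
begin

definition mat_eigenvector :: "real^'n^'n \<Rightarrow> real^'n \<Rightarrow> real \<Rightarrow> bool"
  where "mat_eigenvector M v l \<longleftrightarrow> v \<noteq> 0 \<and> M *v v = l *\<^sub>R v"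

definition mat_eigenvalue :: "real^'n^'n \<Rightarrow> real \<Rightarrow> bool"
  where "mat_eigenvalue M l \<longleftrightarrow> (\<exists>v. mat_eigenvector M v l)"

definition mat_eigenspace :: "real^'n^'n \<Rightarrow> real \<Rightarrow> (real^'n) set"
  where "mat_eigenspace M l = {v. M *v v = l *\<^sub>R v}"

definition geometric_multiplicity :: "real^'n^'n \<Rightarrow> real \<Rightarrow> nat"
  where "geometric_multiplicity M l = dim (mat_eigenspace M l)"

definition mat_invariant :: "real^'n^'n \<Rightarrow> (real^'n) set \<Rightarrow> bool"
  where "mat_invariant M W \<longleftrightarrow> (*v) M ` W \<subseteq> W"

end

theory Submission
  imports Defs
begin

text \<open>Put \<open>A = M - \<lambda>I\<close>. The kernel of \<open>A\<close> is the line through \<open>v\<^sub>R\<close>, so if \<open>v\<^sub>R \<notin> W\<close> then \<open>A\<close> is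
  injective on the invariant subspace \<open>W\<close>, hence maps \<open>W\<close> onto itself by finite dimension. But \<open>v\<^sub>L\<close>
  is in the kernel of the transpose of \<open>A\<close> and so is orthogonal to the range of \<open>A\<close>.\<close>

text \<open>Injectivity on \<open>W\<close> preserves dimension, and a subspace of \<open>W\<close>
  with the dimension of \<open>W\<close> is all of \<open>W\<close>.\<close>

lemma subspace_linear_image_eq:
  fixes f :: "'a::euclidean_space \<Rightarrow> 'a"
  assumes f: "linear f" and W: "subspace W" and inj: "inj_on f W" and sub: "f ` W \<subseteq> W"
  shows "f ` W = W"
proof (rule subspace_dim_equal)
  show "subspace (f ` W)"
    using f W by (rule linear_subspace_image)
  have "inj_on f (span W)"
    using inj W by (metis span_eq_iff)
  then show "dim (f ` W) \<ge> dim W"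
    using dim_image_eq[OF f] by simp
qed (use W sub in auto)

lemma subspace_dim_1_eq_span:
  fixes v :: "'a::euclidean_space"
  assumes "subspace S" and "dim S = 1" and "v \<in> S" and "v \<noteq> 0"
  shows "S = span {v}"
proof -
  have "span {v} = S"
    using assms by (intro subspace_dim_equal) (auto simp: span_minimal)
  then show ?thesis ..
qed

theorem lemma5p1:
  fixes M :: "real^'n^'n" and l :: real and v\<^sub>L v\<^sub>R :: "real^'n" and W :: "(real^'n) set"
  assumes "mat_eigenvalue M l"
    and "geometric_multiplicity M l = 1"
    and "mat_eigenvector (transpose M) v\<^sub>L l"
    and "mat_eigenvector M v\<^sub>R l"
    and "subspace W"
    and "mat_invariant M W"
  shows "v\<^sub>R \<in> W \<or> v\<^sub>L \<in> W\<^sup>\<bottom>"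
proof (subst disj_imp, rule impI)
  assume vR: "v\<^sub>R \<notin> W"
  define f where "f x = M *v x - l *\<^sub>R x" for x
  have f: "linear f"
    unfolding f_def by (intro linear_compose_sub matrix_vector_mul_linear linear_scale_self)
  have ker: "mat_eigenspace M l = {x. f x = 0}"
    by (auto simp: mat_eigenspace_def f_def)
  have "subspace (mat_eigenspace M l)"
    unfolding ker using f by (rule linear_subspace_kernel)
  \<comment> \<open>Multiplicity 1 enters here: it makes every kernel vector of \<open>f\<close> a
    multiple of \<open>v\<^sub>R\<close>.\<close>
  then have eig: "mat_eigenspace M l = span {v\<^sub>R}"
    using assms(2,4) by (intro subspace_dim_1_eq_span)
      (auto simp: geometric_multiplicity_def mat_eigenvector_def mat_eigenspace_def)
  have "inj_on f W"
  proof (subst linear_injective_on_subspace_0[OF f \<open>subspace W\<close>], intro ballI impI)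
    fix x assume x: "x \<in> W" "f x = 0"
    then obtain c where c: "x = c *\<^sub>R v\<^sub>R"
      using eig ker by (auto simp: span_singleton)
    show "x = 0"
    proof (rule ccontr)
      assume "x \<noteq> 0"
      \<comment> \<open>Since \<open>x\<close> is nonzero, so is \<open>c\<close>; solving for
        \<open>v\<^sub>R\<close> would put it in \<open>W\<close>.\<close>
      then have "v\<^sub>R = inverse c *\<^sub>R x"
        using c by simp
      then show False
        using vR x(1) \<open>subspace W\<close> by (simp add: subspace_scale)
    qed
  qed
  moreover have "f ` W \<subseteq> W"
    using assms(5,6) by (auto simp: f_def mat_invariant_def intro!: subspace_diff subspace_scale)
  ultimately have surj: "f ` W = W"
    using f \<open>subspace W\<close> by (intro subspace_linear_image_eq)
  \<comment> \<open>Moving \<open>M\<close> across the inner product turns it into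
    \<open>transpose M\<close>, which scales \<open>v\<^sub>L\<close> by \<open>l\<close>; the two
    terms of \<open>f x\<close> then cancel.\<close>
  have "f x \<bullet> v\<^sub>L = 0" for x
  proof -
    have "(M *v x) \<bullet> v\<^sub>L = x \<bullet> (transpose M *v v\<^sub>L)"
      by (metis dot_lmul_matrix inner_commute transpose_matrix_vector)
    then show ?thesis
      using assms(3) by (simp add: f_def mat_eigenvector_def inner_diff_left)
  qed
  then have "orthogonal y v\<^sub>L" if "y \<in> W" for y
    unfolding orthogonal_def using that surj by (metis imageE)
  then show "v\<^sub>L \<in> W\<^sup>\<bottom>"
    by (simp add: orthogonal_comp_def)
qed

end
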